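(* Let $r$ be a positive integer and let $(\lambda_1,\dots,\lambda_r)$ be an $r$-tuple of negative real numbers such that $$\lambda_i\notin\bigcup_{\theta\in\Theta}\sigma\{A(\theta)\},\qquad i=1,\dots,r .$$ Set $\Lambda=\mathrm{Diag}\{\lambda_1,\dots,\lambda_r\}\in\mathbb{R}^{r\times r}$, let $L=(1,\dots,1)^\top\in\mathbb{R}^r$, and define $g:\mathbb{R}^r\times\mathbb{R}\to\mathbb{R}^r$ by $g(w,u)=\Lambda w+Lu$. Then there exists a $C^1$ function $T:\mathbb{R}^n\times\Theta\times\mathbb{R}^r\to\mathbb{R}^r$, affine in $x$, such that for all $(x,\theta,w)\in\mathbb{R}^n\times\Theta\times\mathbb{R}^r$ and all $u\in\mathbb{R}$, $$\frac{\partial T}{\partial x}(x,\theta,w)\,[A(\theta)x+B(\theta)u]+\frac{\partial T}{\partial w}(x,\theta,w)\,g(w,u)=\Lambda T(x,\theta,w)+L\,C(\theta)x .$$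
   Context: Consider the parameterized linear single-input single-output system $\dot x=A(\theta)x+B(\theta)u$, $y=C(\theta)x$, with state $x\in\mathbb{R}^n$, input $u\in\mathbb{R}$, output $y\in\mathbb{R}$ and parameter $\theta\in\Theta\subset\mathbb{R}^q$. The maps $A:\Theta\to\mathbb{R}^{n\times n}$, $B:\Theta\to\mathbb{R}^{n\times 1}$, $C:\Theta\to\mathbb{R}^{1\times n}$ are $C^1$. Here $\sigma\{M\}$ denotes the spectrum of a matrix $M$. A function is called $C^1$ on $\Theta$ (or on a product with $\Theta$ as one factor) if it is the restriction of a $C^1$ function defined on an open neighbourhood. *)

theory Defs
  imports "HOL-Analysis.Analysis"
begin

text \<open>The spectrum of a real square matrix, as usual a set of complex numbers.\<close>

definition spectrum :: "real^'n^'n \<Rightarrow> complex set" where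
  "spectrum M = {z. \<exists>v :: complex^'n. v \<noteq> 0 \<and> map_matrix complex_of_real M *v v = z *s v}"

definition diag_matrix :: "real^'r \<Rightarrow> real^'r^'r" where
  "diag_matrix d = (\<chi> i j. if i = j then d $ i else 0)"

definition C1_open :: "'a set \<Rightarrow> ('a::real_normed_vector \<Rightarrow> 'b::real_normed_vector) \<Rightarrow> bool" where
  "C1_open U f \<longleftrightarrow> open U \<and>
     (\<exists>f' :: 'a \<Rightarrow> ('a \<Rightarrow>\<^sub>L 'b).
        (\<forall>x\<in>U. (f has_derivative blinfun_apply (f' x)) (at x)) \<and> continuous_on U f')"

text \<open>On an arbitrary set \<open>S\<close>, being \<open>C\<^sup>1\<close> means being the restriction of a \<open>C\<^sup>1\<close> function
  defined on an open neighbourhood of \<open>S\<close>.  Values of \<open>f\<close> outside \<open>S\<close> are irrelevant.\<close>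

definition C1_on :: "'a set \<Rightarrow> ('a::real_normed_vector \<Rightarrow> 'b::real_normed_vector) \<Rightarrow> bool" where
  "C1_on S f \<longleftrightarrow> (\<exists>U h. S \<subseteq> U \<and> C1_open U h \<and> (\<forall>x\<in>S. f x = h x))"

definition affine_map :: "('a::real_vector \<Rightarrow> 'b::real_vector) \<Rightarrow> bool" where
  "affine_map f \<longleftrightarrow> (\<exists>h c. linear h \<and> (\<forall>x. f x = h x + c))"

end

theory Submission
  imports Defs
begin

text \<open>The \<open>i\<close>-th component of \<open>T\<close> is sought as \<open>m\<^sub>i(\<theta>) \<bullet> x + n\<^sub>i(\<theta>) w\<^sub>i\<close>. Comparing coefficients
  of \<open>x\<close> and \<open>u\<close>, the equation becomes \<open>(A(\<theta>) - \<lambda>\<^sub>i I)\<^sup>\<top> m\<^sub>i(\<theta>) = C(\<theta>)\<^sup>\<top>\<close> and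
  \<open>n\<^sub>i(\<theta>) = - m\<^sub>i(\<theta>) \<bullet> B(\<theta>)\<close>. The first system is uniquely solvable because \<open>\<lambda>\<^sub>i\<close> is not an
  eigenvalue of \<open>A(\<theta>)\<close>, and Cramer's rule shows that its solution is \<open>C\<^sup>1\<close> in \<open>\<theta>\<close>, also on a
  neighbourhood of \<open>\<Theta>\<close> where the determinants stay nonzero.\<close>

section \<open>Closure properties of \<open>C1_open\<close>\<close>

lemma C1_open_subset:
  assumes "C1_open U f" "open V" "V \<subseteq> U"
  shows "C1_open V f"
  using assms unfolding C1_open_def by (meson continuous_on_subset subsetD)

lemma C1_open_imp_continuous_on:
  assumes "C1_open U f"
  shows "continuous_on U f"
  using assms unfolding C1_open_def
  by (meson continuous_at_imp_continuous_on has_derivative_continuous)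

lemma C1_open_const: "open U \<Longrightarrow> C1_open U (\<lambda>x. c)"
  unfolding C1_open_def by (auto intro!: exI[of _ "\<lambda>x. 0"] derivative_eq_intros)

lemma C1_open_linear_compose:
  assumes h: "bounded_linear h" and f: "C1_open U f"
  shows "C1_open U (\<lambda>x. h (f x))"
proof -
  obtain f' where f': "\<And>x. x \<in> U \<Longrightarrow> (f has_derivative blinfun_apply (f' x)) (at x)"
    "continuous_on U f'" and U: "open U"
    using f unfolding C1_open_def by blast
  show ?thesis
    unfolding C1_open_def
  proof (intro conjI exI[of _ "\<lambda>x. Blinfun h o\<^sub>L f' x"] ballI)
    fix x assume "x \<in> U"
    from bounded_linear.has_derivative[OF h f'(1)[OF this]]
    show "((\<lambda>x. h (f x)) has_derivative blinfun_apply (Blinfun h o\<^sub>L f' x)) (at x)"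
      by (rule has_derivative_eq_rhs) (auto simp: bounded_linear_Blinfun_apply[OF h])
  qed (auto intro!: continuous_intros f' U)
qed

lemma C1_open_minus: "C1_open U f \<Longrightarrow> C1_open U (\<lambda>x. - f x)"
  by (rule C1_open_linear_compose[OF bounded_linear_minus[OF bounded_linear_ident]])

text \<open>Chain rule with a linear inner map. It serves to regard a function of \<theta> alone as
  a function of the triple (x, \<theta>, w), with \<open>p\<close> the projection.\<close>

lemma C1_open_compose_linear:
  assumes p: "bounded_linear p" and f: "C1_open U f"
  shows "C1_open (p -` U) (\<lambda>x. f (p x))"
proof -
  obtain f' where f': "\<And>x. x \<in> U \<Longrightarrow> (f has_derivative blinfun_apply (f' x)) (at x)"
    "continuous_on U f'" and U: "open U"
    using f unfolding C1_open_def by blast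
  have cont: "continuous_on S p" for S
    using p by (rule linear_continuous_on)
  show ?thesis
    unfolding C1_open_def
  proof (intro conjI exI[of _ "\<lambda>x. f' (p x) o\<^sub>L Blinfun p"] ballI)
    show "open (p -` U)"
      using U cont by (rule open_vimage)
  next
    fix x assume "x \<in> p -` U"
    then have "(f has_derivative blinfun_apply (f' (p x))) (at (p x))"
      using f' by auto
    from has_derivative_compose[OF bounded_linear_imp_has_derivative[OF p] this]
    show "((\<lambda>x. f (p x)) has_derivative blinfun_apply (f' (p x) o\<^sub>L Blinfun p)) (at x)"
      by (rule has_derivative_eq_rhs) (auto simp: bounded_linear_Blinfun_apply[OF p])
  next
    have "continuous_on (p -` U) (\<lambda>x. f' (p x))"
      by (rule continuous_on_compose2[OF f'(2) cont]) auto
    then show "continuous_on (p -` U) (\<lambda>x. f' (p x) o\<^sub>L Blinfun p)"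
      by (intro continuous_intros)
  qed
qed

lemma C1_open_add:
  assumes "C1_open U f" "C1_open U g"
  shows "C1_open U (\<lambda>x. f x + g x)"
proof -
  obtain f' g' where "\<And>x. x \<in> U \<Longrightarrow> (f has_derivative blinfun_apply (f' x)) (at x)"
    "\<And>x. x \<in> U \<Longrightarrow> (g has_derivative blinfun_apply (g' x)) (at x)"
    "continuous_on U f'" "continuous_on U g'" "open U"
    using assms unfolding C1_open_def by blast
  then show ?thesis
    unfolding C1_open_def
    by (auto intro!: exI[of _ "\<lambda>x. f' x + g' x"] derivative_eq_intros continuous_intros
        simp: blinfun.add_left)
qed

lemma C1_open_mult:
  fixes f g :: "'a::real_normed_vector \<Rightarrow> real"
  assumes "C1_open U f" "C1_open U g"
  shows "C1_open U (\<lambda>x. f x * g x)"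
proof -
  obtain f' g' where f': "\<And>x. x \<in> U \<Longrightarrow> (f has_derivative blinfun_apply (f' x)) (at x)"
    "\<And>x. x \<in> U \<Longrightarrow> (g has_derivative blinfun_apply (g' x)) (at x)"
    "continuous_on U f'" "continuous_on U g'" and U: "open U"
    using assms unfolding C1_open_def by blast
  show ?thesis
    unfolding C1_open_def
  proof (intro conjI exI[of _ "\<lambda>x. f x *\<^sub>R g' x + g x *\<^sub>R f' x"] ballI)
    fix x assume "x \<in> U"
    from has_derivative_mult[OF f'(1)[OF this] f'(2)[OF this]]
    show "((\<lambda>x. f x * g x) has_derivative blinfun_apply (f x *\<^sub>R g' x + g x *\<^sub>R f' x)) (at x)"
      by (rule has_derivative_eq_rhs) (auto simp: blinfun.add_left blinfun.scaleR_left)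
  qed (auto intro!: continuous_intros f' U assms[THEN C1_open_imp_continuous_on])
qed

text \<open>Needed for the denominators in Cramer's rule; the derivative is
  \<open>- f' / f^2\<close>, continuous because \<open>f\<close> does not vanish on
  \<open>U\<close>.\<close>

lemma C1_open_inverse:
  fixes f :: "'a::real_normed_vector \<Rightarrow> real"
  assumes f: "C1_open U f" and nz: "\<And>x. x \<in> U \<Longrightarrow> f x \<noteq> 0"
  shows "C1_open U (\<lambda>x. inverse (f x))"
proof -
  obtain f' where f': "\<And>x. x \<in> U \<Longrightarrow> (f has_derivative blinfun_apply (f' x)) (at x)"
    "continuous_on U f'" and U: "open U"
    using f unfolding C1_open_def by blast
  show ?thesis
    unfolding C1_open_def
  proof (intro conjI exI[of _ "\<lambda>x. (- (inverse (f x) * inverse (f x))) *\<^sub>R f' x"] ballI)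
    fix x assume "x \<in> U"
    from Deriv.has_derivative_inverse[OF nz[OF this] f'(1)[OF this]]
    show "((\<lambda>x. inverse (f x)) has_derivative
        blinfun_apply ((- (inverse (f x) * inverse (f x))) *\<^sub>R f' x)) (at x)"
      by (rule has_derivative_eq_rhs) (auto simp: blinfun.minus_left blinfun.scaleR_left)
  qed (auto intro!: continuous_intros f' U f[THEN C1_open_imp_continuous_on] simp: nz)
qed

lemma C1_open_sum:
  assumes "open U" "\<And>i. i \<in> I \<Longrightarrow> C1_open U (f i)"
  shows "C1_open U (\<lambda>x. \<Sum>i\<in>I. f i x)"
  using assms(2)
  \<comment> \<open>An infinite \<open>I\<close> gives the default sum 0, a constant, so no
    finiteness has to be assumed.\<close>
  by (induction I rule: infinite_finite_induct)
    (auto intro!: C1_open_const C1_open_add assms(1))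

lemma C1_open_prod:
  fixes f :: "'i \<Rightarrow> 'a::real_normed_vector \<Rightarrow> real"
  assumes "open U" "\<And>i. i \<in> I \<Longrightarrow> C1_open U (f i)"
  shows "C1_open U (\<lambda>x. \<Prod>i\<in>I. f i x)"
  using assms(2)
  by (induction I rule: infinite_finite_induct)
    (auto intro!: C1_open_const C1_open_mult assms(1))

text \<open>By the Leibniz formula the determinant is a polynomial in the entries, so sums and
  products suffice.\<close>

lemma C1_open_det:
  fixes M :: "'a::real_normed_vector \<Rightarrow> real^'n^'n"
  assumes "open U" "\<And>i j. C1_open U (\<lambda>x. M x $ i $ j)"
  shows "C1_open U (\<lambda>x. det (M x))"
  unfolding det_def by (intro C1_open_sum C1_open_mult C1_open_prod C1_open_const assms)

lemma C1_open_vec_lambda: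
  fixes f :: "'i::finite \<Rightarrow> 'a::real_normed_vector \<Rightarrow> real"
  assumes "open U" "\<And>i. C1_open U (f i)"
  shows "C1_open U (\<lambda>x. \<chi> i. f i x)"
proof -
  \<comment> \<open>Expanding in the standard basis reduces the claim to sums of scalar functions
    followed by linear maps.\<close>
  have "(\<lambda>x. \<chi> i. f i x) = (\<lambda>x. \<Sum>i\<in>UNIV. f i x *\<^sub>R axis i 1)"
    by (auto simp: vec_eq_iff axis_def if_distrib cong: if_cong)
  then show ?thesis
    by (auto intro!: C1_open_sum assms
        C1_open_linear_compose[of "\<lambda>r. r *\<^sub>R axis _ 1"] bounded_linear_intros)
qed

lemma C1_open_component:
  "C1_open U f \<Longrightarrow> C1_open U (\<lambda>x. f x $ i)"
  by (rule C1_open_linear_compose[OF bounded_linear_vec_nth])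

section \<open>Derivatives of affine maps, spectra, and linear systems with a parameter\<close>

lemma frechet_derivative_linear_add_const:
  fixes h :: "'a::euclidean_space \<Rightarrow> 'b::real_normed_vector"
  assumes "linear h"
  shows "frechet_derivative (\<lambda>x. h x + c) (at x) = h"
  using assms
  \<comment> \<open>\<open>frechet_derivative\<close> is defined by choice; uniqueness of the
    derivative identifies the chosen map with \<open>h\<close>, which is bounded in finite
    dimension.\<close>
  by (intro frechet_derivative_at[symmetric] has_derivative_add_const
      bounded_linear_imp_has_derivative linear_conv_bounded_linear[THEN iffD1])

lemma mat_vector_mult: "mat c *v x = c *\<^sub>R x" for x :: "real^'n"
  by (simp add: vec_eq_iff matrix_vector_mult_def mat_def if_distrib[of "\<lambda>a. a * _"]
      cong: if_cong)

text \<open>A singular real matrix has a nonzero real kernel vector. Embedded into the complex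
  vectors it is an eigenvector in the sense of \<open>spectrum\<close>.\<close>

lemma real_eigenvalue_in_spectrum:
  fixes M :: "real^'n^'n"
  assumes "det (M - mat l) = 0"
  shows "complex_of_real l \<in> spectrum M"
proof -
  have "\<not> (\<forall>v. (M - mat l) *v v = 0 \<longrightarrow> v = 0)"
    using assms invertible_det_nz[of "M - mat l"] invertible_left_inverse[of "M - mat l"]
      matrix_left_invertible_ker[of "M - mat l"] by auto
  then obtain v where v: "(M - mat l) *v v = 0" "v \<noteq> 0"
    by auto
  have "M *v v = l *\<^sub>R v"
    using v(1) by (simp add: matrix_vector_mult_diff_rdistrib mat_vector_mult)
  then have "(\<Sum>j\<in>UNIV. M $ i $ j * v $ j) = l * v $ i" for i
    by (simp add: vec_eq_iff matrix_vector_mult_def)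
  then have "(\<Sum>j\<in>UNIV. complex_of_real (M $ i $ j) * complex_of_real (v $ j))
      = complex_of_real l * complex_of_real (v $ i)" for i
    by (metis (no_types, lifting) of_real_mult of_real_sum sum.cong)
  then have "map_matrix complex_of_real M *v (\<chi> i. complex_of_real (v $ i))
      = complex_of_real l *s (\<chi> i. complex_of_real (v $ i))"
    by (simp add: vec_eq_iff matrix_vector_mult_def map_matrix_def)
  moreover have "(\<chi> i. complex_of_real (v $ i)) \<noteq> 0"
    using v(2) by (simp add: vec_eq_iff)
  ultimately show ?thesis
    unfolding spectrum_def by blast
qed

lemma diag_matrix_vector_mult: "diag_matrix d *v w = (\<chi> i. d $ i * w $ i)"
  by (simp add: vec_eq_iff diag_matrix_def matrix_vector_mult_def
      if_distrib[of "\<lambda>a. a * _"] cong: if_cong)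

lemma C1_open_cramer_solution:
  fixes M :: "'a::real_normed_vector \<Rightarrow> real^'n^'n" and b :: "'a \<Rightarrow> real^'n"
  assumes U: "open U" and M: "\<And>i j. C1_open U (\<lambda>x. M x $ i $ j)"
    and b: "\<And>i. C1_open U (\<lambda>x. b x $ i)" and nz: "\<And>x. x \<in> U \<Longrightarrow> det (M x) \<noteq> 0"
  obtains m where "\<And>k. C1_open U (\<lambda>x. m x $ k)" "\<And>x. x \<in> U \<Longrightarrow> M x *v m x = b x"
proof
  \<comment> \<open>\<open>N k x\<close> is the Cramer numerator matrix: column \<open>k\<close> of
    \<open>M x\<close> is replaced by \<open>b x\<close>. The quotient in \<open>m\<close> is
    written with \<open>inverse\<close> to fit the closure rules.\<close>
  define N where "N = (\<lambda>k x. (\<chi> i j. if j = k then b x $ i else M x $ i $ j) :: real^'n^'n)"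
  define m where "m = (\<lambda>x. (\<chi> k. det (N k x) * inverse (det (M x))) :: real^'n)"
  have "C1_open U (\<lambda>x. N k x $ i $ j)" for i j k
    unfolding N_def by (cases "j = k") (auto intro: M b)
  then show "C1_open U (\<lambda>x. m x $ k)" for k
    unfolding m_def by (auto intro!: C1_open_mult C1_open_inverse C1_open_det U M nz)
  show "M x *v m x = b x" if "x \<in> U" for x
    unfolding cramer[OF nz[OF that]] by (simp add: m_def N_def divide_inverse)
qed

theorem theorem1:
  fixes \<Theta> :: "(real^'q) set"
    and A :: "real^'q \<Rightarrow> real^'n^'n"
    and B :: "real^'q \<Rightarrow> real^1^'n"
    and C :: "real^'q \<Rightarrow> real^'n^1"
    and lam :: "real^'r"
    and \<Lambda> :: "real^'r^'r"
    and L :: "real^'r"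
    and g :: "real^'r \<Rightarrow> real \<Rightarrow> real^'r"
  assumes "C1_on \<Theta> A" and "C1_on \<Theta> B" and "C1_on \<Theta> C"
    and "\<And>i. lam $ i < 0"
    and "\<And>i. complex_of_real (lam $ i) \<notin> (\<Union>\<theta>\<in>\<Theta>. spectrum (A \<theta>))"
    and "\<Lambda> = diag_matrix lam"
    and "L = (\<chi> i. 1)"
    and "g = (\<lambda>w u. \<Lambda> *v w + u *\<^sub>R L)"
  shows "\<exists>T :: (real^'n) \<times> (real^'q) \<times> (real^'r) \<Rightarrow> real^'r.
           C1_on (UNIV \<times> \<Theta> \<times> UNIV) T \<and>
           (\<forall>\<theta>\<in>\<Theta>. \<forall>w. affine_map (\<lambda>x. T (x, \<theta>, w))) \<and>
           (\<forall>x. \<forall>\<theta>\<in>\<Theta>. \<forall>w u.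
              frechet_derivative (\<lambda>x'. T (x', \<theta>, w)) (at x) (A \<theta> *v x + B \<theta> *v vec u)
              + frechet_derivative (\<lambda>w'. T (x, \<theta>, w')) (at w) (g w u)
              = \<Lambda> *v T (x, \<theta>, w) + (C \<theta> *v x) $ 1 *\<^sub>R L)"
proof -

  \<comment> \<open>Coefficients on a neighbourhood of \<Theta>\<close>
  obtain UA hA where A: "\<Theta> \<subseteq> UA" "C1_open UA hA" "\<And>\<theta>. \<theta> \<in> \<Theta> \<Longrightarrow> A \<theta> = hA \<theta>"
    using assms(1) unfolding C1_on_def by blast
  obtain UB hB where B: "\<Theta> \<subseteq> UB" "C1_open UB hB" "\<And>\<theta>. \<theta> \<in> \<Theta> \<Longrightarrow> B \<theta> = hB \<theta>"
    using assms(2) unfolding C1_on_def by blast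
  obtain UC hC where C: "\<Theta> \<subseteq> UC" "C1_open UC hC" "\<And>\<theta>. \<theta> \<in> \<Theta> \<Longrightarrow> C \<theta> = hC \<theta>"
    using assms(3) unfolding C1_on_def by blast
  \<comment> \<open>The extension \<open>hA\<close> replaces \<open>A\<close>, so that the systems
    make sense off \<Theta>. The transpose turns the row equation for \<open>m\<close> into a column
    system.\<close>
  define M where "M = (\<lambda>i \<theta>. transpose (hA \<theta> - mat (lam $ i)))"
  define V where "V = UA \<inter> UB \<inter> UC"
  have V: "open V"
    using A(2) B(2) C(2) by (auto simp: V_def C1_open_def)
  have hA: "C1_open V (\<lambda>\<theta>. hA \<theta> $ i $ j)" for i j
    by (intro C1_open_component C1_open_subset[OF A(2)] V) (auto simp: V_def)
  have hB: "C1_open V (\<lambda>\<theta>. hB \<theta> $ i $ j)" for i j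
    by (intro C1_open_component C1_open_subset[OF B(2)] V) (auto simp: V_def)
  have hC: "C1_open V (\<lambda>\<theta>. hC \<theta> $ i $ j)" for i j
    by (intro C1_open_component C1_open_subset[OF C(2)] V) (auto simp: V_def)
  have M: "C1_open V (\<lambda>\<theta>. M k \<theta> $ i $ j)" for i j k
    using C1_open_add[OF hA[of j i] C1_open_const[OF V, of "- (mat (lam $ k) $ j $ i)"]]
    by (simp add: M_def transpose_def)
  \<comment> \<open>The product encodes that all determinants are nonzero by one continuous
    function, so openness of \<open>U\<close> is a single preimage argument.\<close>
  define U where "U = {\<theta> \<in> V. (\<Prod>i\<in>UNIV. det (M i \<theta>)) \<noteq> 0}"
  have "continuous_on V (\<lambda>\<theta>. \<Prod>i\<in>UNIV. det (M i \<theta>))"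
    by (intro C1_open_imp_continuous_on C1_open_prod C1_open_det V M)
  from continuous_open_preimage[OF this V, of "- {0}"]
  have "open (V \<inter> (\<lambda>\<theta>. \<Prod>i\<in>UNIV. det (M i \<theta>)) -` (- {0}))"
    by blast
  also have "V \<inter> (\<lambda>\<theta>. \<Prod>i\<in>UNIV. det (M i \<theta>)) -` (- {0}) = U"
    by (auto simp: U_def)
  finally have U: "open U" .
  have "U \<subseteq> V"
    by (auto simp: U_def)
  note onU = C1_open_subset[OF _ U this]
  have detU: "det (M i \<theta>) \<noteq> 0" if "\<theta> \<in> U" for i \<theta>
    using that by (auto simp: U_def)
  \<comment> \<open>Here the spectral hypothesis enters: on \<Theta> a zero determinant would make
    \<open>lam $ i\<close> an eigenvalue of \<open>A \<theta>\<close>.\<close>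
  have "det (M i \<theta>) \<noteq> 0" if "\<theta> \<in> \<Theta>" for i \<theta>
    using real_eigenvalue_in_spectrum[of "A \<theta>" "lam $ i"] assms(5)[of i] that A(3)[OF that]
    by (auto simp: M_def)
  then have \<Theta>U: "\<Theta> \<subseteq> U"
    using A(1) B(1) C(1) by (auto simp: U_def V_def)
  have "\<exists>m. (\<forall>k. C1_open U (\<lambda>\<theta>. m \<theta> $ k)) \<and> (\<forall>\<theta>\<in>U. M i \<theta> *v m \<theta> = hC \<theta> $ 1)" for i
    by (rule C1_open_cramer_solution[of U "M i" "\<lambda>\<theta>. hC \<theta> $ 1"])
      (use U onU[OF M] onU[OF hC] detU in auto)
  then obtain m where m: "\<And>i k. C1_open U (\<lambda>\<theta>. m i \<theta> $ k)"
    "\<And>i \<theta>. \<theta> \<in> U \<Longrightarrow> M i \<theta> *v m i \<theta> = hC \<theta> $ 1"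
    by metis
  \<comment> \<open>Chosen so that the terms in \<open>u\<close> cancel; index 1 selects the only
    column of \<open>hB \<theta>\<close>.\<close>
  define n where "n = (\<lambda>i \<theta>. - (\<Sum>k\<in>UNIV. m i \<theta> $ k * hB \<theta> $ k $ 1))"
  have n: "C1_open U (n i)" for i
    unfolding n_def sum_negf[symmetric] mult_minus_left[symmetric]
    by (intro C1_open_sum C1_open_mult C1_open_minus U m onU[OF hB])
  define T :: "(real^'n) \<times> (real^'q) \<times> (real^'r) \<Rightarrow> real^'r"
    where "T = (\<lambda>(x, \<theta>, w). \<chi> i. m i \<theta> \<bullet> x + n i \<theta> * w $ i)"

  \<comment> \<open>Verification of smoothness, affinity and the differential equation\<close>
  show ?thesis
  proof (intro exI[of _ T] conjI ballI allI)
    define W :: "((real^'n) \<times> (real^'q) \<times> (real^'r)) set" where "W = (\<lambda>p. fst (snd p)) -` U"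
    have fs: "bounded_linear (\<lambda>p :: (real^'n) \<times> (real^'q) \<times> (real^'r). fst (snd p))"
      by (intro bounded_linear_intros)
    have pull: "C1_open W (\<lambda>p. f (fst (snd p)))" if "C1_open U f" for f :: "real^'q \<Rightarrow> real"
      using C1_open_compose_linear[OF fs that] by (simp add: W_def)
    have W: "open W"
      using pull[OF n] by (simp add: C1_open_def)
    have lin: "C1_open W f" if "bounded_linear f" for f :: "_ \<Rightarrow> real"
      using that W unfolding C1_open_def
      by (auto intro!: exI[of _ "\<lambda>p. Blinfun f"] bounded_linear_imp_has_derivative
          simp: bounded_linear_Blinfun_apply)
    have x: "C1_open W (\<lambda>p. fst p $ k)" for k
      by (intro lin bounded_linear_compose[OF bounded_linear_vec_nth] bounded_linear_fst)
    have w: "C1_open W (\<lambda>p. snd (snd p) $ k)" for k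
      by (intro lin bounded_linear_compose[OF bounded_linear_vec_nth] bounded_linear_intros)
    \<comment> \<open>In coordinates \<open>T\<close> is built by sums and products from functions
      of \<theta> and coordinate projections. It is \<open>C1_open\<close> on all of
      \<open>W\<close>, hence serves as its own extension.\<close>
    have "T = (\<lambda>p. \<chi> i. (\<Sum>k\<in>UNIV. m i (fst (snd p)) $ k * fst p $ k)
        + n i (fst (snd p)) * snd (snd p) $ i)"
      by (auto simp: T_def inner_vec_def)
    moreover have "C1_open W \<dots>"
      by (intro C1_open_vec_lambda W C1_open_add C1_open_sum C1_open_mult x w
          pull[OF m(1)] pull[OF n])
    moreover have "UNIV \<times> \<Theta> \<times> UNIV \<subseteq> W"
      using \<Theta>U by (auto simp: W_def)
    ultimately show "C1_on (UNIV \<times> \<Theta> \<times> UNIV) T"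
      unfolding C1_on_def by metis
  next
    fix \<theta> w
    have "linear (\<lambda>x. \<chi> i. m i \<theta> \<bullet> x)"
      by (auto intro!: linearI simp: vec_eq_iff inner_add_right)
    then show "affine_map (\<lambda>x. T (x, \<theta>, w))"
      unfolding affine_map_def
      by (intro exI[of _ "\<lambda>x. \<chi> i. m i \<theta> \<bullet> x"] exI[of _ "\<chi> i. n i \<theta> * w $ i"])
        (auto simp: T_def vec_eq_iff)
  next
    fix x \<theta> w u assume \<theta>: "\<theta> \<in> \<Theta>"
    have split: "(\<lambda>x'. T (x', \<theta>, w)) = (\<lambda>x'. (\<chi> i. m i \<theta> \<bullet> x') + (\<chi> i. n i \<theta> * w $ i))"
      "(\<lambda>w'. T (x, \<theta>, w')) = (\<lambda>w'. (\<chi> i. n i \<theta> * w' $ i) + (\<chi> i. m i \<theta> \<bullet> x))"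
      by (auto simp: T_def vec_eq_iff)
    have Dx: "frechet_derivative (\<lambda>x'. T (x', \<theta>, w)) (at x) = (\<lambda>x'. \<chi> i. m i \<theta> \<bullet> x')"
      unfolding split
      by (intro frechet_derivative_linear_add_const)
        (auto intro!: linearI simp: vec_eq_iff inner_add_right)
    have Dw: "frechet_derivative (\<lambda>w'. T (x, \<theta>, w')) (at w) = (\<lambda>w'. \<chi> i. n i \<theta> * w' $ i)"
      unfolding split
      by (intro frechet_derivative_linear_add_const)
        (auto intro!: linearI simp: vec_eq_iff algebra_simps)
    \<comment> \<open>This is the system for \<open>m i \<theta>\<close> paired with
      \<open>x\<close>, the transpose being moved across the inner product.\<close>
    have mA: "m i \<theta> \<bullet> (A \<theta> *v x) = lam $ i * (m i \<theta> \<bullet> x) + (C \<theta> *v x) $ 1" for i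
    proof -
      have "(C \<theta> *v x) $ 1 = (M i \<theta> *v m i \<theta>) \<bullet> x"
        unfolding m(2)[OF subsetD[OF \<Theta>U \<theta>]] C(3)[OF \<theta>]
        by (simp add: matrix_vector_mult_def inner_vec_def)
      also have "\<dots> = m i \<theta> \<bullet> ((hA \<theta> - mat (lam $ i)) *v x)"
        by (simp add: M_def dot_lmul_matrix)
      also have "\<dots> = m i \<theta> \<bullet> (A \<theta> *v x) - m i \<theta> \<bullet> (mat (lam $ i) *v x)"
        using A(3)[OF \<theta>] by (simp add: matrix_vector_mult_diff_rdistrib inner_diff_right)
      finally show ?thesis
        by (simp add: mat_vector_mult)
    qed
    have mB: "m i \<theta> \<bullet> (B \<theta> *v vec u) = - n i \<theta> * u" for i
      using B(3)[OF \<theta>]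
      by (simp add: n_def matrix_vector_mult_def inner_vec_def sum_distrib_right mult.assoc)
    show "frechet_derivative (\<lambda>x'. T (x', \<theta>, w)) (at x) (A \<theta> *v x + B \<theta> *v vec u)
        + frechet_derivative (\<lambda>w'. T (x, \<theta>, w')) (at w) (g w u)
        = \<Lambda> *v T (x, \<theta>, w) + (C \<theta> *v x) $ 1 *\<^sub>R L"
      \<comment> \<open>In component \<open>i\<close>, \<open>mA\<close> gives the terms in
        \<open>x\<close>, both sides contain \<open>n i \<theta> * lam $ i * w $ i\<close>, and by
        \<open>mB\<close> the contributions of \<open>u\<close> cancel.\<close>
      unfolding Dx Dw assms(6-8) diag_matrix_vector_mult
      by (simp add: vec_eq_iff T_def inner_add_right mA mB algebra_simps)
  qed
qed

end
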